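(* Let $\mathcal S$ be a Baire space. Then there is a bijective correspondence between the contents on $\mathfrak R(\mathcal S)$ and the residual charges on $\mathfrak{Ba}(\mathcal S)$. To be precise: if $\nu$ is a residual charge on $\mathfrak{Ba}(\mathcal S)$, then the restriction of $\nu$ to $\mathfrak R(\mathcal S)$ is a content on $\mathfrak R(\mathcal S)$; every content on $\mathfrak R(\mathcal S)$ arises in this fashion; and no two distinct residual charges on $\mathfrak{Ba}(\mathcal S)$ produce the same content.
   Context: A topological space is a Baire space if the intersection of any countable family of open dense sets is dense. An open set $R\subseteq\mathcal S$ is regular if $R=\mathrm{int}(\mathrm{clos}(R))$. $\mathfrak R(\mathcal S)$ is the set of regular open subsets of $\mathcal S$; it is a Boolean algebra with meet $\cap$, join $Q\vee R:=\mathrm{int}(\mathrm{clos}(Q\cup R))$ and complement $\neg R:=\mathrm{int}(\mathcal S\setminus R)$. A content on $\mathfrak R(\mathcal S)$ is a function $\mu:\mathfrak R(\mathcal S)\to[0,\infty)$ such that $\mu[B_1\vee\cdots\vee B_N]=\sum_{n=1}^N\mu[B_n]$ for every finite collection of disjoint elements $B_1,\dots,B_N$; by standing assumption contents are normalized: $\mu[\mathcal S]=1$. A subset of $\mathcal S$ is nowhere dense if its closure has empty interior, and meager if it is a countable union of nowhere dense sets. $\mathfrak{Ba}(\mathcal S)$ is the collection of all subsets of $\mathcal S$ with the Baire property, i.e. of the form $O\,\triangle\, M$ with $O$ open and $M$ meager; it is a sigma-algebra under the usual set operations, and contains $\mathfrak R(\mathcal S)$ as a subset. A probability charge on $\mathfrak{Ba}(\mathcal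 S)$ is a function $\nu:\mathfrak{Ba}(\mathcal S)\to[0,1]$ with $\nu[\mathcal S]=1$ and $\nu[A\sqcup B]=\nu[A]+\nu[B]$ for disjoint $A,B$. A residual charge is a probability charge $\nu$ with $\nu[M]=0$ for every meager $M\subseteq\mathcal S$. *)

theory Defs
  imports "HOL-Analysis.Analysis"
begin

definition Baire_space :: "'a topology \<Rightarrow> bool" where
  "Baire_space X \<longleftrightarrow>
     (\<forall>\<U>. countable \<U> \<longrightarrow> (\<forall>U\<in>\<U>. openin X U \<and> X closure_of U = topspace X) \<longrightarrow>
          X closure_of (topspace X \<inter> \<Inter>\<U>) = topspace X)"

definition regular_opens :: "'a topology \<Rightarrow> 'a set set" where
  "regular_opens X = {R. openin X R \<and> R = X interior_of (X closure_of R)}"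

definition regular_join :: "'a topology \<Rightarrow> 'a set \<Rightarrow> 'a set \<Rightarrow> 'a set" where
  "regular_join X Q R = X interior_of (X closure_of (Q \<union> R))"

text \<open>The subset condition is needed because \<open>closure_of\<close> ignores points outside the space.\<close>

definition nowhere_dense_in :: "'a topology \<Rightarrow> 'a set \<Rightarrow> bool" where
  "nowhere_dense_in X N \<longleftrightarrow> N \<subseteq> topspace X \<and> X interior_of (X closure_of N) = {}"

definition meager_in :: "'a topology \<Rightarrow> 'a set \<Rightarrow> bool" where
  "meager_in X M \<longleftrightarrow> (\<exists>\<N>. countable \<N> \<and> (\<forall>N\<in>\<N>. nowhere_dense_in X N) \<and> M = \<Union>\<N>)"

definition Baire_property_sets :: "'a topology \<Rightarrow> 'a set set" where
  "Baire_property_sets X = {sym_diff U M | U M. openin X U \<and> meager_in X M}"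

text \<open>
  Contents and charges are extensional functions on their domains, so that two of them are
  equal exactly when they agree on their domain.

  The finite collection \<open>B\<^sub>1, \<dots>, B\<^sub>N\<close> is a list of pairwise disjoint sets and
  \<open>B\<^sub>1 \<or> \<dots> \<or> B\<^sub>N\<close> is the iterated binary join, starting from the bottom element \<open>{}\<close>.
\<close>

definition contents :: "'a topology \<Rightarrow> ('a set \<Rightarrow> real) set" where
  "contents X =
     {\<mu> \<in> regular_opens X \<rightarrow>\<^sub>E {0..}.
        \<mu> (topspace X) = 1 \<and>
        (\<forall>Bs. set Bs \<subseteq> regular_opens X \<longrightarrow> sorted_wrt disjnt Bs \<longrightarrow>
           \<mu> (foldr (regular_join X) Bs {}) = (\<Sum>B\<leftarrow>Bs. \<mu> B))}"

definition probability_charges :: "'a topology \<Rightarrow> ('a set \<Rightarrow> real) set" where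
  "probability_charges X =
     {\<nu> \<in> Baire_property_sets X \<rightarrow>\<^sub>E {0..1}.
        \<nu> (topspace X) = 1 \<and>
        (\<forall>A\<in>Baire_property_sets X. \<forall>B\<in>Baire_property_sets X.
           disjnt A B \<longrightarrow> \<nu> (A \<union> B) = \<nu> A + \<nu> B)}"

definition residual_charges :: "'a topology \<Rightarrow> ('a set \<Rightarrow> real) set" where
  "residual_charges X = {\<nu> \<in> probability_charges X. \<forall>M. meager_in X M \<longrightarrow> \<nu> M = 0}"

end

theory Submission
  imports Defs
begin

text \<open>
  Modulo meager sets, every set with the Baire property equals a regular open set: pass from an
  open set \<open>U\<close> to the interior of its closure, which differs from \<open>U\<close> by a nowhere dense set. In a
  Baire space this regular open set is unique, because a nonempty open set is not meager. A residual
  charge does not see meager sets, so it is determined by its values on regular open sets; conversely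
  a content \<open>\<mu>\<close> extends by evaluating it at the regular open representative, and representatives of
  disjoint sets are disjoint, with the representative of the union being the join.
\<close>

section \<open>Nowhere dense and meager sets, and the Baire condition\<close>

lemma nowhere_dense_in_imp_meager_in: "nowhere_dense_in X N \<Longrightarrow> meager_in X N"
  unfolding meager_in_def by (rule exI[of _ "{N}"]) auto

lemma nowhere_dense_in_mono: "nowhere_dense_in X N \<Longrightarrow> A \<subseteq> N \<Longrightarrow> nowhere_dense_in X A"
  unfolding nowhere_dense_in_def
  using interior_of_mono[OF closure_of_mono] by fast

lemma meager_in_subset_topspace: "meager_in X M \<Longrightarrow> M \<subseteq> topspace X"
  unfolding meager_in_def nowhere_dense_in_def by auto

lemma meager_in_empty [simp]: "meager_in X {}"
  unfolding meager_in_def by (rule exI[of _ "{}"]) auto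

lemma meager_in_mono:
  assumes "meager_in X M" "A \<subseteq> M"
  shows "meager_in X A"
proof -
  obtain \<N> where \<N>: "countable \<N>" "\<And>N. N \<in> \<N> \<Longrightarrow> nowhere_dense_in X N" "M = \<Union>\<N>"
    using assms(1) unfolding meager_in_def by blast
  \<comment> \<open>Each nowhere dense piece of \<open>M\<close> is cut down to \<open>A\<close>,
    which keeps it nowhere dense.\<close>
  have "A = \<Union>((\<inter>) A ` \<N>)"
    using assms(2) \<N>(3) by auto
  moreover have "\<forall>N\<in>(\<inter>) A ` \<N>. nowhere_dense_in X N"
    using \<N>(2) nowhere_dense_in_mono by (metis imageE Int_lower2)
  ultimately show ?thesis
    unfolding meager_in_def using \<N>(1) by blast
qed

lemma meager_in_Un:
  assumes "meager_in X A" "meager_in X B"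
  shows "meager_in X (A \<union> B)"
proof -
  obtain \<A> \<B> where "countable \<A>" "\<forall>N\<in>\<A>. nowhere_dense_in X N" "A = \<Union>\<A>"
    "countable \<B>" "\<forall>N\<in>\<B>. nowhere_dense_in X N" "B = \<Union>\<B>"
    using assms unfolding meager_in_def by auto
  then show ?thesis
    unfolding meager_in_def by (intro exI[of _ "\<A> \<union> \<B>"]) auto
qed

text \<open>The complements of the closures of the nowhere dense pieces are open and dense, so by
  the Baire condition their intersection is dense. It misses \<open>U\<close>, and an open set that
  misses a dense set is empty.\<close>

lemma Baire_space_meager_open_empty:
  assumes "Baire_space X" "meager_in X U" "openin X U"
  shows "U = {}"
proof -
  obtain \<N> where \<N>: "countable \<N>" "\<And>N. N \<in> \<N> \<Longrightarrow> nowhere_dense_in X N" "U = \<Union>\<N>"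
    using assms(2) unfolding meager_in_def by blast
  define \<U> where "\<U> = (\<lambda>N. topspace X - X closure_of N) ` \<N>"
  have "\<forall>V\<in>\<U>. openin X V \<and> X closure_of V = topspace X"
    using \<N>(2)
    by (auto simp: \<U>_def nowhere_dense_in_def closure_of_complement)
  moreover have "countable \<U>"
    using \<N>(1) by (simp add: \<U>_def)
  ultimately have dense: "X closure_of (topspace X \<inter> \<Inter>\<U>) = topspace X"
    using assms(1)[unfolded Baire_space_def, rule_format, of \<U>] by simp
  have "N \<subseteq> X closure_of N" if "N \<in> \<N>" for N
    using \<N>(2)[OF that] by (simp add: nowhere_dense_in_def closure_of_subset)
  then have "U \<inter> (topspace X \<inter> \<Inter>\<U>) = {}"
    unfolding \<U>_def \<N>(3) by fastforce
  then have "U \<inter> topspace X = {}"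
    using openin_Int_closure_of_eq_empty[OF assms(3)] dense by metis
  then show ?thesis
    using openin_subset[OF assms(3)] by auto
qed

section \<open>Boundaries of open sets, regular open sets and joins\<close>

text \<open>The boundary is closed, so only its interior has to be empty. That interior is an open
  set disjoint from \<open>U\<close>, hence disjoint from the closure of \<open>U\<close>, in which
  it lies.\<close>

lemma nowhere_dense_in_closure_of_Diff:
  assumes "openin X U"
  shows "nowhere_dense_in X (X closure_of U - U)"
proof -
  let ?W = "X interior_of (X closure_of U - U)"
  have "?W \<inter> U = {}"
    using interior_of_subset[of X "X closure_of U - U"] by auto
  then have "?W \<inter> X closure_of U = {}"
    by (simp add: openin_Int_closure_of_eq_empty)
  then have "?W = {}"
    using interior_of_subset[of X "X closure_of U - U"] by blast
  moreover have "closedin X (X closure_of U - U)"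
    using assms by (simp add: closedin_diff)
  ultimately show ?thesis
    by (simp add: nowhere_dense_in_def closure_of_closedin closedin_subset)
qed

text \<open>The regularization lies between \<open>U\<close> and its closure, so the error is
  contained in the nowhere dense boundary of \<open>U\<close>.\<close>

lemma meager_in_sym_diff_regularization:
  assumes "openin X U"
  shows "meager_in X (sym_diff U (X interior_of (X closure_of U)))"
proof (rule meager_in_mono)
  show "meager_in X (X closure_of U - U)"
    using assms nowhere_dense_in_closure_of_Diff nowhere_dense_in_imp_meager_in by blast
  have "U \<subseteq> X interior_of (X closure_of U)"
    using assms by (simp add: closure_of_subset interior_of_maximal openin_subset)
  then show "sym_diff U (X interior_of (X closure_of U)) \<subseteq> X closure_of U - U"
    using interior_of_subset[of X "X closure_of U"] by auto
qed

lemma regular_opens_imp_openin: "R \<in> regular_opens X \<Longrightarrow> openin X R"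
  by (simp add: regular_opens_def)

lemma regularization_in_regular_opens: "X interior_of (X closure_of U) \<in> regular_opens X"
proof -
  let ?R = "X interior_of (X closure_of U)"
  have "X closure_of ?R \<subseteq> X closure_of U"
    by (simp add: closure_of_minimal interior_of_subset)
  then have "X interior_of (X closure_of ?R) \<subseteq> ?R"
    by (rule interior_of_mono)
  moreover have "?R \<subseteq> X interior_of (X closure_of ?R)"
    by (simp add: closure_of_subset interior_of_maximal interior_of_subset_topspace)
  ultimately show ?thesis
    by (auto simp: regular_opens_def)
qed

lemma regular_join_in_regular_opens: "regular_join X Q R \<in> regular_opens X"
  unfolding regular_join_def by (rule regularization_in_regular_opens)

lemma empty_in_regular_opens [simp]: "{} \<in> regular_opens X"
  by (simp add: regular_opens_def)

lemma topspace_in_regular_opens [simp]: "topspace X \<in> regular_opens X"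
  by (simp add: regular_opens_def)

lemma regular_join_empty: "R \<in> regular_opens X \<Longrightarrow> regular_join X R {} = R"
  by (simp add: regular_join_def regular_opens_def)

lemma foldr_regular_join_in_regular_opens: "foldr (regular_join X) Bs {} \<in> regular_opens X"
  by (cases Bs) (auto simp: regular_join_in_regular_opens)

text \<open>An open set disjoint from \<open>Q \<union> R\<close> is disjoint from its closure, and
  the join lies in that closure.\<close>

lemma disjnt_regular_join:
  assumes "openin X B" "disjnt B Q" "disjnt B R"
  shows "disjnt B (regular_join X Q R)"
proof -
  have "B \<inter> X closure_of (Q \<union> R) = {}"
    using assms by (subst openin_Int_closure_of_eq_empty) (auto simp: disjnt_def)
  then show ?thesis
    using interior_of_subset[of X "X closure_of (Q \<union> R)"]
    by (auto simp: disjnt_def regular_join_def)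
qed

lemma disjnt_foldr_regular_join:
  assumes "openin X B" "\<forall>C\<in>set Bs. disjnt B C"
  shows "disjnt B (foldr (regular_join X) Bs {})"
  using assms(2) by (induction Bs) (auto intro: disjnt_regular_join[OF assms(1)])

text \<open>This links the two kinds of additivity: the join, used by contents, and the union, used
  by charges, agree up to a meager set.\<close>

lemma meager_in_sym_diff_regular_join:
  assumes "openin X Q" "openin X R"
  shows "meager_in X (sym_diff (Q \<union> R) (regular_join X Q R))"
  unfolding regular_join_def using assms by (intro meager_in_sym_diff_regularization) auto

section \<open>The Baire property and regular open sets modulo meager sets\<close>

lemma openin_in_Baire_property_sets: "openin X U \<Longrightarrow> U \<in> Baire_property_sets X"
  unfolding Baire_property_sets_def using meager_in_empty
  by (intro CollectI exI[of _ U] exI[of _ "{}"]) simp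

lemma meager_in_Baire_property_sets: "meager_in X M \<Longrightarrow> M \<in> Baire_property_sets X"
  unfolding Baire_property_sets_def by (intro CollectI exI[of _ "{}"] exI[of _ M]) simp

lemma regular_opens_subset_Baire_property_sets: "regular_opens X \<subseteq> Baire_property_sets X"
  using openin_in_Baire_property_sets regular_opens_imp_openin by blast

lemma meager_in_sym_diff_trans:
  assumes "meager_in X (sym_diff A B)" "meager_in X (sym_diff B C)"
  shows "meager_in X (sym_diff A C)"
  by (rule meager_in_mono[OF meager_in_Un[OF assms]]) auto

text \<open>From left to right, the open set is replaced by its regularization at the cost of
  another meager error. From right to left, taking the symmetric difference with \<open>R\<close>
  twice gives back \<open>A\<close>.\<close>

lemma Baire_property_sets_iff_regular_open:
  "A \<in> Baire_property_sets X \<longleftrightarrow> (\<exists>R\<in>regular_opens X. meager_in X (sym_diff A R))"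
proof
  assume "A \<in> Baire_property_sets X"
  then obtain U M where UM: "openin X U" "meager_in X M" "A = sym_diff U M"
    by (auto simp: Baire_property_sets_def)
  have "sym_diff A U = M"
    using UM(3) by auto
  then have "meager_in X (sym_diff A (X interior_of (X closure_of U)))"
    using UM meager_in_sym_diff_regularization meager_in_sym_diff_trans by metis
  then show "\<exists>R\<in>regular_opens X. meager_in X (sym_diff A R)"
    using regularization_in_regular_opens by blast
next
  assume "\<exists>R\<in>regular_opens X. meager_in X (sym_diff A R)"
  then obtain R where "R \<in> regular_opens X" "meager_in X (sym_diff A R)"
    by blast
  moreover have "A = sym_diff R (sym_diff A R)"
    by auto
  ultimately show "A \<in> Baire_property_sets X"
    unfolding Baire_property_sets_def using regular_opens_imp_openin by blast
qed

lemma Baire_property_sets_subset_topspace: "A \<in> Baire_property_sets X \<Longrightarrow> A \<subseteq> topspace X"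
  unfolding Baire_property_sets_def
  by (auto dest!: openin_subset meager_in_subset_topspace)

text \<open>The complement of \<open>A\<close> is approximated by the exterior of \<open>R\<close>.
  The error is covered by that of \<open>R\<close> together with the boundary of \<open>R\<close>.
  Complements serve below to bound the extended charge by 1.\<close>

lemma Baire_property_sets_Compl:
  assumes "A \<in> Baire_property_sets X"
  shows "topspace X - A \<in> Baire_property_sets X"
proof -
  obtain R where R: "R \<in> regular_opens X" "meager_in X (sym_diff A R)"
    using assms Baire_property_sets_iff_regular_open by blast
  then have "openin X R"
    by (simp add: regular_opens_imp_openin)
  let ?S = "topspace X - X closure_of R"
  have "R \<subseteq> X closure_of R"
    using \<open>openin X R\<close> by (simp add: closure_of_subset openin_subset)
  then have "sym_diff (topspace X - A) ?S \<subseteq> sym_diff A R \<union> (X closure_of R - R)"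
    using Baire_property_sets_subset_topspace[OF assms] by auto
  moreover have "meager_in X (X closure_of R - R)"
    using \<open>openin X R\<close> by (simp add: nowhere_dense_in_closure_of_Diff nowhere_dense_in_imp_meager_in)
  ultimately have "meager_in X (sym_diff (topspace X - A) ?S)"
    using meager_in_mono[OF meager_in_Un[OF R(2)]] by blast
  moreover have "topspace X - A = sym_diff ?S (sym_diff (topspace X - A) ?S)"
    by blast
  moreover have "openin X ?S"
    by (simp add: openin_diff)
  ultimately show ?thesis
    unfolding Baire_property_sets_def by blast
qed

section \<open>Uniqueness of the regular open representative\<close>

text \<open>The part of \<open>R\<close> outside the closure of \<open>S\<close> is open and meager,
  hence empty. So the open set \<open>R\<close> lies in the interior of the closure of
  \<open>S\<close>, which is \<open>S\<close> by regularity.\<close>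

lemma regular_open_subset_if_meager_Diff:
  assumes "Baire_space X" "R \<in> regular_opens X" "S \<in> regular_opens X" "meager_in X (R - S)"
  shows "R \<subseteq> S"
proof -
  have open_RS: "openin X R" "openin X S"
    using assms by (auto simp: regular_opens_imp_openin)
  have "R - X closure_of S \<subseteq> R - S"
    using open_RS(2) by (meson Diff_mono closure_of_subset openin_subset order_refl)
  then have "R - X closure_of S = {}"
    using open_RS assms(1,4)
    by (intro Baire_space_meager_open_empty[of X]) (auto intro: meager_in_mono)
  then have "R \<subseteq> X interior_of (X closure_of S)"
    using open_RS(1) by (simp add: interior_of_maximal)
  then show ?thesis
    using assms(3) by (simp add: regular_opens_def)
qed

lemma regular_opens_eq_if_meager_sym_diff:
  assumes "Baire_space X" "R \<in> regular_opens X" "S \<in> regular_opens X"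
    and "meager_in X (sym_diff A R)" "meager_in X (sym_diff A S)"
  shows "R = S"
proof -
  have "meager_in X (sym_diff A R \<union> sym_diff A S)"
    by (rule meager_in_Un[OF assms(4,5)])
  then have "meager_in X (R - S)" "meager_in X (S - R)"
    by (auto elim!: meager_in_mono)
  then show ?thesis
    using assms regular_open_subset_if_meager_Diff by (metis subset_antisym)
qed

text \<open>For \<open>A\<close> with the Baire property a representative exists in every space; in
  a Baire space it is unique, so that the choice is then immaterial.\<close>

definition regular_rep :: "'a topology \<Rightarrow> 'a set \<Rightarrow> 'a set" where
  "regular_rep X A = (SOME R. R \<in> regular_opens X \<and> meager_in X (sym_diff A R))"

lemma regular_rep:
  assumes "A \<in> Baire_property_sets X"
  shows "regular_rep X A \<in> regular_opens X" "meager_in X (sym_diff A (regular_rep X A))"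
proof -
  have "\<exists>R. R \<in> regular_opens X \<and> meager_in X (sym_diff A R)"
    using assms Baire_property_sets_iff_regular_open by blast
  from someI_ex[OF this] show "regular_rep X A \<in> regular_opens X"
    "meager_in X (sym_diff A (regular_rep X A))"
    by (simp_all add: regular_rep_def)
qed

lemma regular_rep_eqI:
  assumes "Baire_space X" "R \<in> regular_opens X" "meager_in X (sym_diff A R)"
  shows "regular_rep X A = R"
proof -
  have "A \<in> Baire_property_sets X"
    using assms Baire_property_sets_iff_regular_open by blast
  then show ?thesis
    using assms regular_rep regular_opens_eq_if_meager_sym_diff by metis
qed

text \<open>For disjoint \<open>A\<close> and \<open>B\<close>, a common point of the
  representatives lies in one of the two meager errors, so their intersection is open and meager,
  hence empty. The union of the representatives approximates \<open>A \<union> B\<close>, and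
  passing to the join adds only a meager error; uniqueness then identifies the
  representative.\<close>

lemma regular_rep_disjoint:
  assumes "Baire_space X" "A \<in> Baire_property_sets X" "B \<in> Baire_property_sets X" "disjnt A B"
  shows "disjnt (regular_rep X A) (regular_rep X B)"
    and "regular_rep X (A \<union> B) = regular_join X (regular_rep X A) (regular_rep X B)"
proof -
  let ?R = "regular_rep X A" and ?S = "regular_rep X B"
  have reps: "openin X ?R" "openin X ?S"
    using assms regular_rep regular_opens_imp_openin by blast+
  have meager: "meager_in X (sym_diff A ?R \<union> sym_diff B ?S)"
    using assms(2,3) by (intro meager_in_Un[OF regular_rep(2) regular_rep(2)])
  have "?R \<inter> ?S \<subseteq> sym_diff A ?R \<union> sym_diff B ?S"
    using assms(4) by (auto simp: disjnt_def)
  then have "?R \<inter> ?S = {}"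
    using reps assms(1) meager
    by (intro Baire_space_meager_open_empty[of X]) (auto intro: meager_in_mono)
  then show "disjnt ?R ?S"
    by (simp add: disjnt_def)
  have "meager_in X (sym_diff (A \<union> B) (?R \<union> ?S))"
    by (rule meager_in_mono[OF meager]) auto
  then have "meager_in X (sym_diff (A \<union> B) (regular_join X ?R ?S))"
    using meager_in_sym_diff_regular_join[OF reps] meager_in_sym_diff_trans by blast
  then show "regular_rep X (A \<union> B) = regular_join X ?R ?S"
    using assms(1) by (simp add: regular_rep_eqI regular_join_in_regular_opens)
qed

section \<open>Additivity of contents and of residual charges\<close>

lemma contents_regular_join:
  assumes "\<mu> \<in> contents X" "R \<in> regular_opens X" "S \<in> regular_opens X" "disjnt R S"
  shows "\<mu> (regular_join X R S) = \<mu> R + \<mu> S"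
proof -
  \<comment> \<open>The iterated join of \<open>[R, S]\<close> ends in a join with
    \<open>{}\<close>, which leaves the regular open set \<open>S\<close> unchanged.\<close>
  have "set [R, S] \<subseteq> regular_opens X \<longrightarrow> sorted_wrt disjnt [R, S] \<longrightarrow>
      \<mu> (foldr (regular_join X) [R, S] {}) = (\<Sum>B\<leftarrow>[R, S]. \<mu> B)"
    using assms(1) unfolding contents_def by blast
  then show ?thesis
    using assms by (simp add: regular_join_empty)
qed

lemma contents_empty: "\<mu> \<in> contents X \<Longrightarrow> \<mu> {} = 0"
  using contents_regular_join[of \<mu> X "{}" "{}"] by (simp add: regular_join_empty disjnt_def)

lemma residual_chargesD:
  assumes "\<nu> \<in> residual_charges X"
  shows "\<nu> (topspace X) = 1"
    and "\<And>A. A \<in> Baire_property_sets X \<Longrightarrow> 0 \<le> \<nu> A"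
    and "\<And>A B. A \<in> Baire_property_sets X \<Longrightarrow> B \<in> Baire_property_sets X \<Longrightarrow> disjnt A B
      \<Longrightarrow> \<nu> (A \<union> B) = \<nu> A + \<nu> B"
    and "\<And>M. meager_in X M \<Longrightarrow> \<nu> M = 0"
  using assms unfolding residual_charges_def probability_charges_def
  by (auto dest: PiE_mem)

text \<open>Adding the null set \<open>B - A\<close> to \<open>A\<close>, or \<open>A - B\<close> to
  \<open>B\<close>, gives the same union.\<close>

lemma residual_charge_cong:
  assumes "\<nu> \<in> residual_charges X" "A \<in> Baire_property_sets X" "B \<in> Baire_property_sets X"
    and "meager_in X (sym_diff A B)"
  shows "\<nu> A = \<nu> B"
proof -
  have meager: "meager_in X (A - B)" "meager_in X (B - A)"
    using assms(4) by (auto elim!: meager_in_mono)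
  have "\<nu> (A \<union> (B - A)) = \<nu> A + \<nu> (B - A)" "\<nu> (B \<union> (A - B)) = \<nu> B + \<nu> (A - B)"
    using assms(2,3) meager[THEN meager_in_Baire_property_sets]
    by (auto intro!: residual_chargesD(3)[OF assms(1)] simp: disjnt_def simp del: Un_Diff_cancel)
  moreover have "A \<union> (B - A) = B \<union> (A - B)"
    by auto
  ultimately show ?thesis
    using residual_chargesD(4)[OF assms(1)] meager by simp
qed

text \<open>By induction on the list: the head is disjoint from the join of the tail, and their join
  may be replaced by their union because the two differ by a meager set.\<close>

lemma residual_charge_foldr_regular_join:
  assumes "\<nu> \<in> residual_charges X"
  shows "set Bs \<subseteq> regular_opens X \<Longrightarrow> sorted_wrt disjnt Bs \<Longrightarrow>
    \<nu> (foldr (regular_join X) Bs {}) = (\<Sum>B\<leftarrow>Bs. \<nu> B)"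
proof (induction Bs)
  case Nil
  then show ?case
    using residual_chargesD(4)[OF assms] by simp
next
  case (Cons B Bs)
  let ?J = "foldr (regular_join X) Bs {}"
  have opens: "openin X B" "openin X ?J"
    using Cons.prems foldr_regular_join_in_regular_opens
    by (auto intro!: regular_opens_imp_openin)
  have "disjnt B ?J"
    using Cons.prems opens(1) by (intro disjnt_foldr_regular_join) auto
  have "\<nu> (regular_join X B ?J) = \<nu> (B \<union> ?J)"
  proof (rule sym, rule residual_charge_cong[OF assms])
    show "B \<union> ?J \<in> Baire_property_sets X"
      using opens by (intro openin_in_Baire_property_sets) auto
    show "regular_join X B ?J \<in> Baire_property_sets X"
      using regular_join_in_regular_opens regular_opens_subset_Baire_property_sets by blast
    show "meager_in X (sym_diff (B \<union> ?J) (regular_join X B ?J))"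
      using opens by (rule meager_in_sym_diff_regular_join)
  qed
  also have "\<dots> = \<nu> B + \<nu> ?J"
    using opens \<open>disjnt B ?J\<close> by (intro residual_chargesD(3)[OF assms] openin_in_Baire_property_sets)
  finally show ?case
    using Cons by simp
qed

section \<open>Restriction of charges, extension of contents, and the bijection\<close>

lemma restrict_residual_charge_in_contents:
  assumes "\<nu> \<in> residual_charges X"
  shows "restrict \<nu> (regular_opens X) \<in> contents X"
proof -
  let ?\<mu> = "restrict \<nu> (regular_opens X)"
  have "?\<mu> (foldr (regular_join X) Bs {}) = (\<Sum>B\<leftarrow>Bs. ?\<mu> B)"
    if "set Bs \<subseteq> regular_opens X" "sorted_wrt disjnt Bs" for Bs
  proof -
    have "map ?\<mu> Bs = map \<nu> Bs"
      using that(1) by (intro map_cong) auto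
    then show ?thesis
      using residual_charge_foldr_regular_join[OF assms that]
        foldr_regular_join_in_regular_opens[of X Bs] by (metis restrict_apply')
  qed
  moreover have "\<nu> R \<ge> 0" if "R \<in> regular_opens X" for R
    using that residual_chargesD(2)[OF assms] regular_opens_subset_Baire_property_sets by blast
  then have "?\<mu> \<in> regular_opens X \<rightarrow>\<^sub>E {0..}"
    by auto
  moreover have "?\<mu> (topspace X) = 1"
    using residual_chargesD(1)[OF assms] by simp
  ultimately show ?thesis
    unfolding contents_def by blast
qed

lemma content_extends_to_residual_charge:
  assumes "Baire_space X" "\<mu> \<in> contents X"
  shows "\<exists>\<nu>\<in>residual_charges X. restrict \<nu> (regular_opens X) = \<mu>"
proof -
  define \<nu> where "\<nu> = restrict (\<lambda>A. \<mu> (regular_rep X A)) (Baire_property_sets X)"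
  have \<mu>: "\<mu> \<in> regular_opens X \<rightarrow>\<^sub>E {0..}" "\<mu> (topspace X) = 1"
    using assms(2) by (auto simp: contents_def)
  have \<nu>_regular: "\<nu> R = \<mu> R" if "R \<in> regular_opens X" for R
    using that assms(1) regular_opens_subset_Baire_property_sets
    by (auto simp: \<nu>_def regular_rep_eqI)
  then have \<nu>_topspace: "\<nu> (topspace X) = 1"
    using \<mu>(2) by simp
  have nonneg: "0 \<le> \<nu> A" if "A \<in> Baire_property_sets X" for A
    using that regular_rep(1)[OF that] \<mu>(1) by (auto simp: \<nu>_def dest: PiE_mem)
  have add: "\<nu> (A \<union> B) = \<nu> A + \<nu> B"
    if AB: "A \<in> Baire_property_sets X" "B \<in> Baire_property_sets X" "disjnt A B" for A B
  proof -
    note rep = regular_rep(1)[OF AB(1)] regular_rep(1)[OF AB(2)]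
    have reps: "openin X (regular_rep X A)" "openin X (regular_rep X B)"
      using rep by (auto intro: regular_opens_imp_openin)
    have "meager_in X (sym_diff (A \<union> B) (regular_rep X A \<union> regular_rep X B))"
      by (rule meager_in_mono[OF meager_in_Un[OF regular_rep(2)[OF AB(1)] regular_rep(2)[OF AB(2)]]]) auto
    \<comment> \<open>Membership is needed because \<open>\<nu>\<close> is given by
      \<open>\<mu>\<close> and \<open>regular_rep\<close> only on sets with the Baire
      property.\<close>
    then have "A \<union> B \<in> Baire_property_sets X"
      using meager_in_sym_diff_trans[OF _ meager_in_sym_diff_regular_join[OF reps]]
        regular_join_in_regular_opens Baire_property_sets_iff_regular_open by blast
    then show ?thesis
      using AB regular_rep_disjoint[OF assms(1) AB] contents_regular_join[OF assms(2) rep]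
      by (simp add: \<nu>_def)
  qed
  \<comment> \<open>Contents carry no upper bound by definition; here it follows from additivity on
    \<open>A\<close> and its complement, nonnegativity and total mass 1.\<close>
  have le_1: "\<nu> A \<le> 1" if "A \<in> Baire_property_sets X" for A
  proof -
    have "A \<union> (topspace X - A) = topspace X"
      using Baire_property_sets_subset_topspace[OF that] by auto
    then have "\<nu> A + \<nu> (topspace X - A) = 1"
      using add[OF that Baire_property_sets_Compl[OF that]] \<nu>_topspace by (simp add: disjnt_def)
    then show ?thesis
      using nonneg[OF Baire_property_sets_Compl[OF that]] by simp
  qed
  have "\<nu> M = 0" if "meager_in X M" for M
  proof -
    \<comment> \<open>The empty set is regular open and differs from \<open>M\<close> by the meager
      set \<open>M\<close> itself.\<close>
    have "regular_rep X M = {}"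
      using that assms(1) by (intro regular_rep_eqI) auto
    then show ?thesis
      using that assms(2) by (simp add: \<nu>_def meager_in_Baire_property_sets contents_empty)
  qed
  moreover have "\<nu> \<in> Baire_property_sets X \<rightarrow>\<^sub>E {0..1}"
    using nonneg le_1 by (auto simp: \<nu>_def)
  ultimately have "\<nu> \<in> residual_charges X"
    using add \<nu>_topspace by (simp add: residual_charges_def probability_charges_def)
  moreover have "restrict \<nu> (regular_opens X) = \<mu>"
    \<comment> \<open>Both functions are extensional on the regular open sets, so agreement there
      gives equality.\<close>
    using \<mu>(1) \<nu>_regular by (intro extensionalityI[of _ "regular_opens X"]) (auto simp: PiE_def)
  ultimately show ?thesis
    by blast
qed

text \<open>The value of a residual charge at \<open>A\<close> equals its value at the
  representative of \<open>A\<close>, where the two charges agree.\<close>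

lemma inj_on_restrict_residual_charges:
  "inj_on (\<lambda>\<nu>. restrict \<nu> (regular_opens X)) (residual_charges X)"
proof (rule inj_onI)
  fix \<nu> \<nu>'
  assume \<nu>: "\<nu> \<in> residual_charges X" "\<nu>' \<in> residual_charges X"
    and eq: "restrict \<nu> (regular_opens X) = restrict \<nu>' (regular_opens X)"
  show "\<nu> = \<nu>'"
  proof (rule extensionalityI[of _ "Baire_property_sets X"])
    show "\<nu> \<in> extensional (Baire_property_sets X)" "\<nu>' \<in> extensional (Baire_property_sets X)"
      using \<nu> by (auto simp: residual_charges_def probability_charges_def PiE_def)
    fix A
    assume A: "A \<in> Baire_property_sets X"
    have rep: "regular_rep X A \<in> Baire_property_sets X"
      using regular_rep(1)[OF A] regular_opens_subset_Baire_property_sets by blast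
    have "\<nu> A = \<nu> (regular_rep X A)"
      by (rule residual_charge_cong[OF \<nu>(1) A rep regular_rep(2)[OF A]])
    also have "\<dots> = \<nu>' (regular_rep X A)"
      using eq regular_rep(1)[OF A] by (metis restrict_apply')
    also have "\<dots> = \<nu>' A"
      by (rule residual_charge_cong[OF \<nu>(2) A rep regular_rep(2)[OF A], symmetric])
    finally show "\<nu> A = \<nu>' A" .
  qed
qed

theorem proposition3p6:
  fixes X :: "'a topology"
  assumes "Baire_space X"
  shows "bij_betw (\<lambda>\<nu>. restrict \<nu> (regular_opens X)) (residual_charges X) (contents X)
    \<and> (\<forall>\<nu>\<in>residual_charges X. restrict \<nu> (regular_opens X) \<in> contents X)
    \<and> (\<forall>\<mu>\<in>contents X. \<exists>\<nu>\<in>residual_charges X. restrict \<nu> (regular_opens X) = \<mu>)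
    \<and> (\<forall>\<nu>\<in>residual_charges X. \<forall>\<nu>'\<in>residual_charges X.
         \<nu> \<noteq> \<nu>' \<longrightarrow> restrict \<nu> (regular_opens X) \<noteq> restrict \<nu>' (regular_opens X))"
proof -
  let ?r = "\<lambda>\<nu>. restrict \<nu> (regular_opens X)"
  have into: "\<forall>\<nu>\<in>residual_charges X. ?r \<nu> \<in> contents X"
    using restrict_residual_charge_in_contents by blast
  have onto: "\<forall>\<mu>\<in>contents X. \<exists>\<nu>\<in>residual_charges X. ?r \<nu> = \<mu>"
    using content_extends_to_residual_charge[OF assms] by blast
  have inj: "inj_on ?r (residual_charges X)"
    by (rule inj_on_restrict_residual_charges)
  have "?r ` residual_charges X = contents X"
    using into onto by (auto simp del: restrict_apply)
  then have "bij_betw ?r (residual_charges X) (contents X)"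
    using inj by (simp add: bij_betw_def)
  then show ?thesis
    using into onto inj_onD[OF inj] by blast
qed

end
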